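(* Let $k\ge2$ and $m>n\ge2$ be integers. The following are equivalent: (1) there are functions $f_\sigma:m\to n$, indexed by all injections $\sigma$ from a proper initial segment $\{0,\dots,t-1\}$ ($0\le t<k$) of $k$ into $k$, such that for every such $\sigma$ and every $\mathsf{PHP}^m_n$-solution $\{i,j\}$ of $f_\sigma$, there exists $\ell<k$ such that for every such injection $\tau$ extending $\sigma$ for which $\{i,j\}$ is a solution of $f_\tau$, $\ell$ is not in the range of $\tau$; (2) $\mathsf{C}_k\le_{\mathrm W}(\mathsf{PHP}^m_n)'$; (3) $\mathsf{C}_k\le^*_{\mathrm W}(\mathsf{PHP}^m_n)'$.
   Context: A number $N\ge1$ is identified with $\{0,\dots,N-1\}$. A problem $\mathsf{P}$ consists of a nonempty set of instances and, for each instance, a nonempty set of solutions; instances and solutions are coded as elements of Baire space $\mathbb N^{\mathbb N}$ in a standard way. $\mathsf{P}\le_{\mathrm W}\mathsf{Q}$ (Weihrauch reducibility) if there are Turing functionals (effectively continuous partial maps on $\mathbb N^{\mathbb N}$) $\Phi,\Psi$ such that for every $\mathsf{P}$-instance $p$, $\Phi(p)$ is a $\mathsf{Q}$-instance and for every $\mathsf{Q}$-solution $q$ of $\Phi(p)$, $\Psi(p,q)$ is a $\mathsf{P}$-solution of $p$; $\le^*_{\mathrm W}$ is the same with $\Phi,\Psi$ merely continuous. For $m>n\ge2$, $\mathsf{PHP}^m_n$ has as instances all functions $f:m\to n$, with solutions all unordered pairs $\{i,j\}$, $i\ne j$, $f(i)=f(j)$; its jump $(\mathsf{PHP}^m_n)'$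 has as instances all pointwise convergent sequences $(f_s:m\to n)_{s\in\mathbb N}$, with solutions all $\{i,j\}$, $i\ne j$, $\lim_s f_s(i)=\lim_s f_s(j)$. For $k\ge2$, $\mathsf{C}_k$ has as instances those $p\in\mathbb N^{\mathbb N}$ such that at least one $\ell<k$ does not appear in $p$, and the solutions are all such $\ell$. "$\tau$ extends $\sigma$" means $\tau\supseteq\sigma$ as finite functions (allowing $\tau=\sigma$). *)

theory Defs
  imports "HOL-Analysis.Function_Topology" "HOL-Library.Nat_Bijection" "HOL-Library.FuncSet"
begin

type_synonym baire = "nat \<Rightarrow> nat"

text \<open>Oracle computation: partial recursive functions relative to an oracle \<open>p\<close>.
  \<open>rec_eval p e xs y\<close> says that program \<open>e\<close> with oracle \<open>p\<close> halts on the
  arguments \<open>xs\<close> with value \<open>y\<close>.\<close>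

datatype recf =
    Zero
  | Succ
  | Proj nat
  | Query
  | Comp recf "recf list"
  | Prim recf recf
  | Mu recf

inductive rec_eval :: "baire \<Rightarrow> recf \<Rightarrow> nat list \<Rightarrow> nat \<Rightarrow> bool" for p :: baire where
  Zero: "rec_eval p Zero xs 0"
| Succ: "rec_eval p Succ [x] (Suc x)"
| Proj: "i < length xs \<Longrightarrow> rec_eval p (Proj i) xs (xs ! i)"
| Query: "rec_eval p Query [x] (p x)"
| Comp: "list_all2 (\<lambda>g y. rec_eval p g xs y) gs ys \<Longrightarrow> rec_eval p f ys z \<Longrightarrow>
    rec_eval p (Comp f gs) xs z"
| Prim_0: "rec_eval p f xs y \<Longrightarrow> rec_eval p (Prim f g) (0 # xs) y"
| Prim_Suc: "rec_eval p (Prim f g) (x # xs) y \<Longrightarrow> rec_eval p g (x # y # xs) z \<Longrightarrow>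
    rec_eval p (Prim f g) (Suc x # xs) z"
| Mu: "rec_eval p f (y # xs) 0 \<Longrightarrow> (\<forall>z<y. \<exists>v. rec_eval p f (z # xs) (Suc v)) \<Longrightarrow>
    rec_eval p (Mu f) xs y"

inductive_cases rec_eval_ZeroE: "rec_eval p Zero xs y"
inductive_cases rec_eval_SuccE: "rec_eval p Succ xs y"
inductive_cases rec_eval_ProjE: "rec_eval p (Proj i) xs y"
inductive_cases rec_eval_QueryE: "rec_eval p Query xs y"
inductive_cases rec_eval_CompE: "rec_eval p (Comp f gs) xs y"
inductive_cases rec_eval_Prim_0E: "rec_eval p (Prim f g) (0 # xs) y"
inductive_cases rec_eval_Prim_SucE: "rec_eval p (Prim f g) (Suc x # xs) y"
inductive_cases rec_eval_MuE: "rec_eval p (Mu f) xs y"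

lemma rec_eval_deterministic:
  "rec_eval p e xs y \<Longrightarrow> rec_eval p e xs y' \<Longrightarrow> y = y'"
proof (induction arbitrary: y' rule: rec_eval.induct)
  case (Zero xs)
  then show ?case by (rule rec_eval_ZeroE) simp
next
  case (Succ x)
  then show ?case by (rule rec_eval_SuccE) simp
next
  case (Proj i xs)
  from Proj.prems show ?case by (rule rec_eval_ProjE) simp
next
  case (Query x)
  then show ?case by (rule rec_eval_QueryE) simp
next
  case (Comp xs gs ys f z)
  from Comp.prems obtain ys' where
    ys': "list_all2 (\<lambda>g y. rec_eval p g xs y) gs ys'" "rec_eval p f ys' y'"
    by (rule rec_eval_CompE)
  have "ys = ys'"
  proof (rule nth_equalityI)
    show "length ys = length ys'"
      using list_all2_lengthD[OF Comp.IH(1)] list_all2_lengthD[OF ys'(1)] by simp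
    show "ys ! i = ys' ! i" if "i < length ys" for i
    proof -
      have "i < length gs" using that list_all2_lengthD[OF Comp.IH(1)] by simp
      from list_all2_nthD[OF Comp.IH(1) this] list_all2_nthD[OF ys'(1) this]
      show ?thesis by simp
    qed
  qed
  with ys'(2) have "rec_eval p f ys y'" by simp
  then show ?case by (rule Comp.IH(2))
next
  case (Prim_0 f xs y g)
  from Prim_0.prems have "rec_eval p f xs y'" by (rule rec_eval_Prim_0E)
  then show ?case by (rule Prim_0.IH)
next
  case (Prim_Suc f g x xs y z)
  from Prim_Suc.prems obtain w where
    w: "rec_eval p (Prim f g) (x # xs) w" "rec_eval p g (x # w # xs) y'"
    by (rule rec_eval_Prim_SucE)
  have "y = w" using w(1) by (rule Prim_Suc.IH(1))
  with w(2) have "rec_eval p g (x # y # xs) y'" by simp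
  then show ?case by (rule Prim_Suc.IH(2))
next
  case (Mu f y xs)
  from Mu.prems obtain *: "rec_eval p f (y' # xs) 0"
    "\<forall>z<y'. \<exists>v. rec_eval p f (z # xs) (Suc v)"
    by (rule rec_eval_MuE)
  have "\<not> y < y'"
  proof
    assume "y < y'"
    then obtain v where "rec_eval p f (y # xs) (Suc v)" using *(2) by blast
    then have "0 = Suc v" by (rule Mu.IH(1))
    then show False by simp
  qed
  moreover have "\<not> y' < y"
  proof
    assume "y' < y"
    then obtain v where "\<And>w. rec_eval p f (y' # xs) w \<Longrightarrow> Suc v = w" using Mu.IH(2) by blast
    from this[OF *(1)] show False by simp
  qed
  ultimately show ?case by simp
qed

text \<open>Partial maps on Baire space are functions into \<open>option\<close>; the value of a Turing functional
  is defined iff the program halts on every argument. Baire space carries the library's product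
  topology of the discrete space \<open>nat\<close>.\<close>

definition turing_functional :: "(baire \<Rightarrow> baire option) \<Rightarrow> bool" where
  "turing_functional F \<longleftrightarrow>
     (\<exists>e. \<forall>p q. F p = Some q \<longleftrightarrow> (\<forall>n. rec_eval p e [n] (q n)))"

definition continuous_functional :: "(baire \<Rightarrow> baire option) \<Rightarrow> bool" where
  "continuous_functional F \<longleftrightarrow> continuous_on (dom F) (\<lambda>p. the (F p))"

definition baire_pair :: "baire \<Rightarrow> baire \<Rightarrow> baire" where
  "baire_pair p q = (\<lambda>n. if even n then p (n div 2) else q (n div 2))"

text \<open>A problem comes with codings (partial maps from Baire space) of its instances and its
  solutions. An element of Baire space is a code of \<open>x\<close> if it is mapped to \<open>Some x\<close>.\<close>

record ('a, 'b) problem =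
  instances :: "'a set"
  solutions :: "'a \<Rightarrow> 'b set"
  inst_rep :: "baire \<Rightarrow> 'a option"
  sol_rep :: "baire \<Rightarrow> 'b option"

definition is_problem :: "('a, 'b) problem \<Rightarrow> bool" where
  "is_problem P \<longleftrightarrow> instances P \<noteq> {} \<and>
     (\<forall>x\<in>instances P. Some x \<in> range (inst_rep P) \<and> solutions P x \<noteq> {} \<and>
        (\<forall>y\<in>solutions P x. Some y \<in> range (sol_rep P)))"

definition inst_codes :: "('a, 'b) problem \<Rightarrow> baire set" where
  "inst_codes P = {p. \<exists>x\<in>instances P. inst_rep P p = Some x}"

definition sol_codes :: "('a, 'b) problem \<Rightarrow> baire \<Rightarrow> baire set" where
  "sol_codes P p =
     {q. \<exists>x y. inst_rep P p = Some x \<and> y \<in> solutions P x \<and> sol_rep P q = Some y}"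

definition reduces_via ::
  "(baire \<Rightarrow> baire option) \<Rightarrow> (baire \<Rightarrow> baire option) \<Rightarrow>
   ('a, 'b) problem \<Rightarrow> ('c, 'd) problem \<Rightarrow> bool" where
  "reduces_via \<Phi> \<Psi> P Q \<longleftrightarrow>
     (\<forall>p\<in>inst_codes P. \<exists>p'\<in>inst_codes Q. \<Phi> p = Some p' \<and>
        (\<forall>q\<in>sol_codes Q p'. \<exists>r\<in>sol_codes P p. \<Psi> (baire_pair p q) = Some r))"

definition weihrauch_le :: "('a, 'b) problem \<Rightarrow> ('c, 'd) problem \<Rightarrow> bool"
    (infix \<open>\<le>\<^sub>W\<close> 50) where
  "P \<le>\<^sub>W Q \<longleftrightarrow>
     (\<exists>\<Phi> \<Psi>. turing_functional \<Phi> \<and> turing_functional \<Psi> \<and> reduces_via \<Phi> \<Psi> P Q)"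

definition weihrauch_cont_le :: "('a, 'b) problem \<Rightarrow> ('c, 'd) problem \<Rightarrow> bool"
    (infix \<open>\<le>\<^sup>*\<^sub>W\<close> 50) where
  "P \<le>\<^sup>*\<^sub>W Q \<longleftrightarrow>
     (\<exists>\<Phi> \<Psi>. continuous_functional \<Phi> \<and> continuous_functional \<Psi> \<and> reduces_via \<Phi> \<Psi> P Q)"

definition choice :: "nat \<Rightarrow> (baire, nat) problem" where
  "choice k = \<lparr>
     instances = {p. \<exists>l<k. l \<notin> range p},
     solutions = (\<lambda>p. {l. l < k \<and> l \<notin> range p}),
     inst_rep = Some,
     sol_rep = (\<lambda>q. Some (q 0))\<rparr>"

definition PHP_instances :: "nat \<Rightarrow> nat \<Rightarrow> (nat \<Rightarrow> nat) set" where
  "PHP_instances m n = {..<m} \<rightarrow>\<^sub>E {..<n}"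

definition PHP_solutions :: "nat \<Rightarrow> (nat \<Rightarrow> nat) \<Rightarrow> nat set set" where
  "PHP_solutions m f = {{i, j} | i j. i < m \<and> j < m \<and> i \<noteq> j \<and> f i = f j}"

text \<open>A sequence \<open>f\<close> of functions on \<open>m\<close> is coded by the \<open>p\<close> whose value \<open>p s\<close> is the code of
  the list of values of \<open>f s\<close>; an unordered pair is coded by any \<open>q\<close> whose first value is the
  canonical index of that finite set.\<close>

definition PHP_jump :: "nat \<Rightarrow> nat \<Rightarrow> (nat \<Rightarrow> nat \<Rightarrow> nat, nat set) problem" where
  "PHP_jump m n = \<lparr>
     instances = {f. (\<forall>s. f s \<in> PHP_instances m n) \<and> (\<forall>i<m. convergent (\<lambda>s. f s i))},
     solutions = (\<lambda>f. PHP_solutions m (\<lambda>i\<in>{..<m}. lim (\<lambda>s. f s i))),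
     inst_rep = (\<lambda>p. if \<forall>s. length (list_decode (p s)) = m
        then Some (\<lambda>s. \<lambda>i\<in>{..<m}. list_decode (p s) ! i) else None),
     sol_rep = (\<lambda>q. Some (set_decode (q 0)))\<rparr>"

definition initial_injections :: "nat \<Rightarrow> (nat \<rightharpoonup> nat) set" where
  "initial_injections k =
     {\<sigma>. (\<exists>t<k. dom \<sigma> = {..<t}) \<and> ran \<sigma> \<subseteq> {..<k} \<and> inj_on \<sigma> (dom \<sigma>)}"

lemma is_problem_choice:
  assumes "k \<ge> 2" shows "is_problem (choice k)"
proof -
  have "(\<lambda>_. 0) \<in> instances (choice k)"
    using assms by (auto simp: choice_def intro!: exI[of _ 1])
  then have "instances (choice k) \<noteq> {}" by blast
  moreover have "Some y \<in> range (sol_rep (choice k))" for y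
    by (auto simp: choice_def intro!: image_eqI[of _ _ "\<lambda>_. y"])
  ultimately show ?thesis by (auto simp: is_problem_def choice_def)
qed

lemma PHP_solutions_nonempty:
  assumes "f \<in> PHP_instances m n" "n < m" shows "PHP_solutions m f \<noteq> {}"
proof -
  have "f ` {..<m} \<subseteq> {..<n}" using assms(1) by (auto simp: PHP_instances_def)
  then have "\<not> inj_on f {..<m}"
    using assms(2) card_inj_on_le[of f "{..<m}" "{..<n}"] by auto
  then show ?thesis by (auto simp: inj_on_def PHP_solutions_def)
qed

lemma lim_in_PHP_instances:
  assumes "f \<in> instances (PHP_jump m n)"
  shows "(\<lambda>i\<in>{..<m}. lim (\<lambda>s. f s i)) \<in> PHP_instances m n"
proof -
  have "lim (\<lambda>s. f s i) < n" if "i < m" for i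
  proof -
    have "(\<lambda>s. f s i) \<longlonglongrightarrow> lim (\<lambda>s. f s i)"
      using assms that by (auto simp: PHP_jump_def convergent_LIMSEQ_iff)
    then have "\<forall>\<^sub>F s in sequentially. f s i = lim (\<lambda>s. f s i)"
      by (simp add: tendsto_discrete)
    then obtain s where "f s i = lim (\<lambda>s. f s i)"
      by (auto simp: eventually_sequentially)
    moreover have "f s i < n" using assms that by (auto simp: PHP_jump_def PHP_instances_def)
    ultimately show ?thesis by simp
  qed
  then show ?thesis by (auto simp: PHP_instances_def)
qed

lemma is_problem_PHP_jump:
  assumes "n \<ge> 2" "m > n" shows "is_problem (PHP_jump m n)"
proof -
  have "(\<lambda>s. \<lambda>i\<in>{..<m}. 0) \<in> instances (PHP_jump m n)"
    using assms by (auto simp: PHP_jump_def PHP_instances_def convergent_const)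
  moreover have "Some f \<in> range (inst_rep (PHP_jump m n))"
    if "f \<in> instances (PHP_jump m n)" for f
  proof -
    have "f s i = undefined" if "\<not> i < m" for s i
      using that \<open>f \<in> _\<close> by (auto simp: PHP_jump_def PHP_instances_def PiE_def extensional_def)
    then have "inst_rep (PHP_jump m n) (\<lambda>s. list_encode (map (f s) [0..<m])) = Some f"
      by (auto simp: PHP_jump_def fun_eq_iff)
    then show ?thesis by (metis rangeI)
  qed
  moreover have "solutions (PHP_jump m n) f \<noteq> {}"
    if "f \<in> instances (PHP_jump m n)" for f
    using PHP_solutions_nonempty[OF lim_in_PHP_instances[OF that] assms(2)]
    by (simp add: PHP_jump_def)
  moreover have "Some S \<in> range (sol_rep (PHP_jump m n))"
    if "S \<in> solutions (PHP_jump m n) f" for S f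
  proof -
    have "finite S" using that by (auto simp: PHP_jump_def PHP_solutions_def)
    then have "sol_rep (PHP_jump m n) (\<lambda>_. set_encode S) = Some S"
      by (simp add: PHP_jump_def)
    then show ?thesis by (metis rangeI)
  qed
  ultimately show ?thesis by (auto simp: is_problem_def)
qed

end

theory Submission
  imports Defs
begin

text \<open>Given the functions \<open>f\<^sub>\<sigma>\<close>, an instance \<open>p\<close> of \<open>C\<^sub>k\<close> enumerates, in order of first appearance, an
  increasing chain of injections \<open>\<sigma>\<^sub>s\<close>, and \<open>f\<^sub>\<sigma>\<close> along this chain is a convergent sequence. A solution
  of its limit is also a solution at some stage \<open>s\<close>, which can be searched for, and the \<open>l\<close> belonging
  to \<open>\<sigma>\<^sub>s\<close> and this solution is never enumerated. All decisions are finite table lookups, so the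
  reduction is computable.

  Conversely, given a continuous reduction, enumerate \<open>\<sigma>\<close> slowly: after each value, pad with the
  neutral symbol \<open>k\<close> until, by continuity, the answer \<open>l\<close> of the backward functional is fixed for each
  of the finitely many solutions of the current limit \<open>f\<^sub>\<sigma>\<close>. An extension \<open>\<tau>\<close> with the same solution
  then gets the same answer, so its range omits \<open>l\<close>.\<close>

section \<open>Continuity in Baire space\<close>

text \<open>The sets \<open>{q. agree N p q}\<close> are the basic neighbourhoods of
  \<open>p\<close>; continuity is handled through them.\<close>

definition agree :: "nat \<Rightarrow> baire \<Rightarrow> baire \<Rightarrow> bool" where
  "agree N p q \<longleftrightarrow> (\<forall>i<N. p i = q i)"

lemma agree_mono: "agree N p q \<Longrightarrow> M \<le> N \<Longrightarrow> agree M p q"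
  by (auto simp: agree_def)

lemma open_agree: "open {q :: baire. agree N p q}"
proof -
  have "{q. agree N p q} = Pi\<^sub>E UNIV (\<lambda>i. if i < N then {p i} else UNIV)"
    by (auto simp: agree_def PiE_iff) (metis singletonD)
  moreover have "open (Pi\<^sub>E UNIV (\<lambda>i. if i < N then {p i} else UNIV) :: baire set)"
    by (rule open_PiE) (auto intro: finite_subset[of _ "{..<N}"] simp: open_discrete)
  ultimately show ?thesis by simp
qed

text \<open>A basic open set of the product topology restricts only finitely many coordinates, and
  these all lie below some \<open>N\<close>.\<close>

lemma open_contains_agree:
  assumes "open (U :: baire set)" "p \<in> U"
  shows "\<exists>N. \<forall>q. agree N p q \<longrightarrow> q \<in> U"
proof -
  have "openin (product_topology (\<lambda>_. euclidean) UNIV) U"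
    using assms(1) by (simp add: open_fun_def)
  from product_topology_open_contains_basis[OF this assms(2)]
  obtain X where X: "p \<in> Pi\<^sub>E UNIV X" "finite {i. X i \<noteq> UNIV}" "Pi\<^sub>E UNIV X \<subseteq> U"
    by auto
  obtain N where N: "{i. X i \<noteq> UNIV} \<subseteq> {..<N}"
    using X(2) finite_nat_iff_bounded by blast
  have "q \<in> U" if "agree N p q" for q
  proof -
    have "q i \<in> X i" for i
    proof (cases "i < N")
      case True
      then have "q i = p i" using that by (simp add: agree_def)
      then show ?thesis using X(1) by (simp add: PiE_iff)
    next
      case False
      then show ?thesis using N by auto
    qed
    then show ?thesis using X(3) by (auto simp: PiE_iff)
  qed
  then show ?thesis by blast
qed

text \<open>Continuity into a product can be checked one coordinate at a time. Only arguments
  \<open>p'\<close> at which \<open>F\<close> is defined are compared, because the topology on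
  \<open>dom F\<close> is the relative one.\<close>

lemma continuous_functional_iff:
  "continuous_functional F \<longleftrightarrow>
     (\<forall>p r n. F p = Some r \<longrightarrow>
       (\<exists>N. \<forall>p' r'. agree N p p' \<longrightarrow> F p' = Some r' \<longrightarrow> r' n = r n))"
proof
  assume cont: "continuous_functional F"
  show "\<forall>p r n. F p = Some r \<longrightarrow>
       (\<exists>N. \<forall>p' r'. agree N p p' \<longrightarrow> F p' = Some r' \<longrightarrow> r' n = r n)"
  proof (intro allI impI)
    fix p r n
    assume Fp: "F p = Some r"
    have "p \<in> dom F" "open {r'. agree (Suc n) r r'}" "the (F p) \<in> {r'. agree (Suc n) r r'}"
      using Fp open_agree by (auto simp: agree_def)
    with cont obtain A where A: "open A" "p \<in> A"
      "\<And>p'. p' \<in> dom F \<Longrightarrow> p' \<in> A \<Longrightarrow> the (F p') \<in> {r'. agree (Suc n) r r'}"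
      unfolding continuous_functional_def continuous_on_topological by meson
    obtain N where N: "\<And>p'. agree N p p' \<Longrightarrow> p' \<in> A"
      using open_contains_agree[OF A(1,2)] by blast
    have "r' n = r n" if "agree N p p'" "F p' = Some r'" for p' r'
      using A(3)[OF _ N[OF that(1)]] that(2) by (simp add: agree_def dom_def)
    then show "\<exists>N. \<forall>p' r'. agree N p p' \<longrightarrow> F p' = Some r' \<longrightarrow> r' n = r n" by blast
  qed
next
  assume *: "\<forall>p r n. F p = Some r \<longrightarrow>
       (\<exists>N. \<forall>p' r'. agree N p p' \<longrightarrow> F p' = Some r' \<longrightarrow> r' n = r n)"
  have "continuous_on (dom F) (\<lambda>p. the (F p) n)" for n
    unfolding continuous_on_topological
  proof (intro ballI allI impI)
    fix p B
    assume p: "p \<in> dom F" and B: "open B" "the (F p) n \<in> B"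
    obtain r where r: "F p = Some r" using p by blast
    obtain N where N: "\<forall>p' r'. agree N p p' \<longrightarrow> F p' = Some r' \<longrightarrow> r' n = r n"
      using * r by blast
    have "the (F y) n \<in> B" if y: "y \<in> dom F" "agree N p y" for y
    proof -
      obtain r' where r': "F y = Some r'" using y(1) by blast
      then have "r' n = r n" using N y(2) by blast
      then show ?thesis using B(2) r r' by simp
    qed
    then show "\<exists>A. open A \<and> p \<in> A \<and> (\<forall>y\<in>dom F. y \<in> A \<longrightarrow> the (F y) n \<in> B)"
      by (intro exI[of _ "{q. agree N p q}"] conjI open_agree) (auto simp: agree_def)
  qed
  then show "continuous_functional F"
    unfolding continuous_functional_def by (rule continuous_on_coordinatewise_then_product)
qed

text \<open>The use principle: a halting computation queries its oracle finitely often. For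
  compositions and searches, the sum of the bounds of the finitely many subcomputations dominates
  each of them.\<close>

lemma rec_eval_use:
  "rec_eval p e xs y \<Longrightarrow> \<exists>N. \<forall>p'. agree N p p' \<longrightarrow> rec_eval p' e xs y"
proof (induction rule: rec_eval.induct)
  case (Query x)
  then show ?case
    by (intro exI[of _ "Suc x"]) (metis agree_def lessI rec_eval.Query)
next
  case (Comp xs gs ys f z)
  have len: "length gs = length ys" using Comp.IH(1) by (rule list_all2_lengthD)
  have "\<forall>i<length gs. \<exists>N. \<forall>p'. agree N p p' \<longrightarrow> rec_eval p' (gs ! i) xs (ys ! i)"
    using list_all2_nthD[OF Comp.IH(1)] by blast
  then obtain N where N: "\<And>i p'. i < length gs \<Longrightarrow> agree (N i) p p' \<Longrightarrow>
      rec_eval p' (gs ! i) xs (ys ! i)"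
    by metis
  obtain M where M: "\<And>p'. agree M p p' \<Longrightarrow> rec_eval p' f ys z" using Comp.IH(2) by blast
  have "rec_eval p' (Comp f gs) xs z"
    if "agree (M + (\<Sum>i<length gs. N i)) p p'" for p'
  proof (rule rec_eval.Comp)
    show "list_all2 (\<lambda>g y. rec_eval p' g xs y) gs ys"
    proof (rule list_all2_all_nthI[OF len])
      fix i assume i: "i < length gs"
      then have "N i \<le> (\<Sum>i<length gs. N i)" by (intro member_le_sum) auto
      then show "rec_eval p' (gs ! i) xs (ys ! i)"
        using N[OF i] agree_mono[OF that] by simp
    qed
    show "rec_eval p' f ys z" using M agree_mono[OF that] by simp
  qed
  then show ?case by blast
next
  case (Prim_Suc f g x xs y z)
  then obtain N M where "\<And>p'. agree N p p' \<Longrightarrow> rec_eval p' (Prim f g) (x # xs) y"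
    "\<And>p'. agree M p p' \<Longrightarrow> rec_eval p' g (x # y # xs) z"
    by blast
  then show ?case
    by (intro exI[of _ "max N M"]) (meson agree_mono max.cobounded1 max.cobounded2 rec_eval.Prim_Suc)
next
  case (Mu f y xs)
  obtain M where M: "\<And>p'. agree M p p' \<Longrightarrow> rec_eval p' f (y # xs) 0" using Mu.IH(1) by blast
  have "\<forall>z<y. \<exists>v N. \<forall>p'. agree N p p' \<longrightarrow> rec_eval p' f (z # xs) (Suc v)"
    using Mu.IH(2) by blast
  then obtain v N where N: "\<And>z p'. z < y \<Longrightarrow> agree (N z) p p' \<Longrightarrow>
      rec_eval p' f (z # xs) (Suc (v z))"
    by metis
  have "rec_eval p' (Mu f) xs y" if "agree (M + (\<Sum>z<y. N z)) p p'" for p'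
  proof (rule rec_eval.Mu)
    show "rec_eval p' f (y # xs) 0" using M agree_mono[OF that] by simp
    have "rec_eval p' f (z # xs) (Suc (v z))" if z: "z < y" for z
    proof -
      have "N z \<le> (\<Sum>z<y. N z)" using z by (intro member_le_sum) auto
      then show ?thesis
        using N[OF z] agree_mono[OF \<open>agree (M + (\<Sum>z<y. N z)) p p'\<close>] by simp
    qed
    then show "\<forall>z<y. \<exists>v. rec_eval p' f (z # xs) (Suc v)" by blast
  qed
  then show ?case by blast
qed (blast intro: rec_eval.intros)+

lemma turing_functional_continuous:
  assumes "turing_functional F"
  shows "continuous_functional F"
  unfolding continuous_functional_iff
proof (intro allI impI)
  fix p r n
  assume Fp: "F p = Some r"
  obtain e where e: "\<And>p q. F p = Some q \<longleftrightarrow> (\<forall>n. rec_eval p e [n] (q n))"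
    using assms by (auto simp: turing_functional_def)
  obtain N where "\<forall>p'. agree N p p' \<longrightarrow> rec_eval p' e [n] (r n)"
    using rec_eval_use[of p e "[n]" "r n"] Fp e by blast
  \<comment> \<open>The computation of \<open>r n\<close> survives with oracle \<open>p'\<close>;
    determinism identifies its value with \<open>r' n\<close>.\<close>
  then show "\<exists>N. \<forall>p' r'. agree N p p' \<longrightarrow> F p' = Some r' \<longrightarrow> r' n = r n"
    using e rec_eval_deterministic by blast
qed

lemma weihrauch_le_imp_cont: "P \<le>\<^sub>W Q \<Longrightarrow> P \<le>\<^sup>*\<^sub>W Q"
  unfolding weihrauch_le_def weihrauch_cont_le_def using turing_functional_continuous by blast

section \<open>Programs for finite tables\<close>

definition functional_of :: "recf \<Rightarrow> baire \<Rightarrow> baire option" where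
  "functional_of e p =
     (if \<exists>q. \<forall>n. rec_eval p e [n] (q n) then Some (THE q. \<forall>n. rec_eval p e [n] (q n)) else None)"

lemma functional_of_eq_Some_iff:
  "functional_of e p = Some q \<longleftrightarrow> (\<forall>n. rec_eval p e [n] (q n))"
proof -
  have uniq: "q1 = q2" if "\<forall>n. rec_eval p e [n] (q1 n)" "\<forall>n. rec_eval p e [n] (q2 n)" for q1 q2
    using that rec_eval_deterministic by blast
  show ?thesis
  proof
    assume "functional_of e p = Some q"
    then have ex: "\<exists>q. \<forall>n. rec_eval p e [n] (q n)"
      and q: "q = (THE q. \<forall>n. rec_eval p e [n] (q n))"
      by (auto simp: functional_of_def split: if_splits)
    show "\<forall>n. rec_eval p e [n] (q n)" unfolding q
      using theI'[of "\<lambda>q. \<forall>n. rec_eval p e [n] (q n)"] ex uniq by blast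
  next
    assume *: "\<forall>n. rec_eval p e [n] (q n)"
    have "(THE q. \<forall>n. rec_eval p e [n] (q n)) = q" using * uniq by (intro the_equality) auto
    then show "functional_of e p = Some q" using * by (auto simp: functional_of_def)
  qed
qed

lemma turing_functional_of: "turing_functional (functional_of e)"
  unfolding turing_functional_def using functional_of_eq_Some_iff by blast

lemma rec_eval_Proj: "i < length xs \<Longrightarrow> v = xs ! i \<Longrightarrow> rec_eval p (Proj i) xs v"
  using rec_eval.Proj by simp

lemma rec_eval_Comp1:
  "rec_eval p g xs y \<Longrightarrow> rec_eval p f [y] z \<Longrightarrow> rec_eval p (Comp f [g]) xs z"
  by (rule rec_eval.Comp[of _ _ _ "[y]"]) auto

lemma rec_eval_Comp2:
  "rec_eval p g xs y \<Longrightarrow> rec_eval p g' xs y' \<Longrightarrow> rec_eval p f [y, y'] z \<Longrightarrow>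
    rec_eval p (Comp f [g, g']) xs z"
  by (rule rec_eval.Comp[of _ _ _ "[y, y']"]) auto

primrec rec_const :: "nat \<Rightarrow> recf" where
  "rec_const 0 = Zero"
| "rec_const (Suc a) = Comp Succ [rec_const a]"

lemma rec_eval_const: "rec_eval p (rec_const a) xs a"
  by (induction a) (auto intro: rec_eval.intros rec_eval_Comp1)

text \<open>The first argument selects a program from the list, which is run on the second argument;
  past the end of the list \<open>d\<close> is run. Each \<open>Prim\<close> peels off one entry:
  its step ignores the accumulated value and passes on the predecessor (\<open>Proj 0\<close>) and
  the second argument (\<open>Proj 2\<close>).\<close>

primrec rec_case :: "recf \<Rightarrow> recf list \<Rightarrow> recf" where
  "rec_case d [] = Comp d [Proj 1]"
| "rec_case d (e # es) = Prim e (Comp (rec_case d es) [Proj 0, Proj 2])"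

text \<open>\<open>Prim\<close> has a value at a successor only if it has one at the predecessor, so
  the hypotheses make every branch halt, not just the selected one.\<close>

lemma rec_eval_case:
  assumes "\<And>i. i < length es \<Longrightarrow> rec_eval p (es ! i) [c] (h i)"
    and "\<And>i. i \<ge> length es \<Longrightarrow> rec_eval p d [c] (h i)"
  shows "rec_eval p (rec_case d es) [x, c] (h x)"
  using assms
proof (induction es arbitrary: h x)
  case Nil
  then show ?case by (auto intro!: rec_eval_Comp1[of _ _ _ c] rec_eval_Proj)
next
  case (Cons e es)
  have IH: "rec_eval p (rec_case d es) [x, c] (h (Suc x))" for x
    using Cons.IH[of "\<lambda>i. h (Suc i)"] Cons.prems(1)[of "Suc _"] Cons.prems(2)[of "Suc _"] by simp
  show ?case
  proof (induction x)
    case 0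
    then show ?case using Cons.prems(1)[of 0] by (auto intro: rec_eval.Prim_0)
  next
    case (Suc x)
    have "rec_eval p (Comp (rec_case d es) [Proj 0, Proj 2]) [x, h x, c] (h (Suc x))"
      by (rule rec_eval_Comp2[OF _ _ IH]) (auto intro: rec_eval_Proj)
    then show ?case using Suc by (auto intro: rec_eval.Prim_Suc)
  qed
qed

definition rec_table :: "nat \<Rightarrow> (nat \<Rightarrow> nat) \<Rightarrow> recf" where
  "rec_table B h = Comp (rec_case Zero (map (\<lambda>i. rec_const (h i)) [0..<B])) [Proj 0, Proj 0]"

lemma rec_eval_table:
  assumes "c < B" shows "rec_eval p (rec_table B h) [c] (h c)"
proof -
  have "rec_eval p (rec_case Zero (map (\<lambda>i. rec_const (h i)) [0..<B])) [c, c]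
      ((\<lambda>i. if i < B then h i else 0) c)"
    by (rule rec_eval_case) (auto intro: rec_eval_const rec_eval.Zero)
  then show ?thesis using assms unfolding rec_table_def
    by (auto intro!: rec_eval_Comp2[of _ _ _ c _ c] rec_eval_Proj)
qed

text \<open>If there is no row \<open>a\<close>, the default \<open>Proj 0\<close> returns
  \<open>c\<close> itself; in \<open>rec_seen\<close> this leaves the state unchanged when a value
  \<open>k\<close> or larger is read.\<close>

definition rec_table2 :: "nat \<Rightarrow> nat \<Rightarrow> (nat \<Rightarrow> nat \<Rightarrow> nat) \<Rightarrow> recf" where
  "rec_table2 A B h = rec_case (Proj 0) (map (\<lambda>a. rec_table B (h a)) [0..<A])"

lemma rec_eval_table2:
  assumes "c < B"
  shows "rec_eval p (rec_table2 A B h) [a, c] (if a < A then h a c else c)"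
  unfolding rec_table2_def
  by (rule rec_eval_case[where h = "\<lambda>a. if a < A then h a c else c"])
    (auto intro: rec_eval_table assms rec_eval_Proj)

definition rec_double :: recf where
  "rec_double = Prim Zero (Comp Succ [Comp Succ [Proj 1]])"

lemma rec_eval_double: "rec_eval p rec_double [x] (2 * x)"
proof (induction x)
  case 0
  show ?case by (auto simp: rec_double_def intro: rec_eval.intros)
next
  case (Suc x)
  have "rec_eval p (Comp Succ [Comp Succ [Proj 1]]) [x, 2 * x] (Suc (Suc (2 * x)))"
    by (intro rec_eval_Comp1[of _ _ _ "Suc (2 * x)"] rec_eval_Comp1[of _ _ _ "2 * x"])
      (auto intro: rec_eval.Succ rec_eval_Proj)
  then show ?case using Suc by (auto simp: rec_double_def intro: rec_eval.Prim_Suc)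
qed

section \<open>From injection-indexed functions to a reduction\<close>

definition list_map :: "nat list \<Rightarrow> nat \<rightharpoonup> nat" where
  "list_map xs = (\<lambda>i. if i < length xs then Some (xs ! i) else None)"

lemma dom_list_map: "dom (list_map xs) = {..<length xs}"
  by (auto simp: list_map_def split: if_splits)

lemma ran_list_map: "ran (list_map xs) = set xs"
  by (auto simp: list_map_def ran_def in_set_conv_nth split: if_splits)

lemma list_map_append: "list_map xs \<subseteq>\<^sub>m list_map (xs @ ys)"
  by (auto simp: list_map_def map_le_def nth_append)

text \<open>Since it misses a value below \<open>k\<close>, the repetition-free list has fewer than
  \<open>k\<close> entries, so its domain is a proper initial segment.\<close>

lemma list_map_in_initial_injections:
  assumes "distinct xs" "set xs \<subset> {..<k}"
  shows "list_map xs \<in> initial_injections k"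
proof -
  have "length xs < k"
    using psubset_card_mono[OF _ assms(2)] distinct_card[OF assms(1)] by simp
  moreover have "inj_on (list_map xs) {..<length xs}"
    using assms(1) by (auto simp: inj_on_def list_map_def nth_eq_iff_index_eq)
  ultimately show ?thesis
    using assms(2) unfolding initial_injections_def by (auto simp: dom_list_map ran_list_map)
qed

section \<open>Values of an instance in order of first appearance\<close>

primrec seen :: "nat \<Rightarrow> baire \<Rightarrow> nat \<Rightarrow> nat list" where
  "seen k p 0 = []"
| "seen k p (Suc s) =
    (if p s < k \<and> p s \<notin> set (seen k p s) then seen k p s @ [p s] else seen k p s)"

lemma set_seen: "set (seen k p s) = p ` {..<s} \<inter> {..<k}"
  by (induction s) (auto simp: lessThan_Suc)

lemma distinct_seen: "distinct (seen k p s)"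
  by (induction s) auto

lemma seen_append: "s \<le> t \<Longrightarrow> \<exists>ys. seen k p t = seen k p s @ ys"
  by (induction t rule: dec_induct) auto

text \<open>Only finitely many values lie below \<open>k\<close>, so those that occur at all have
  occurred by some stage.\<close>

lemma seen_eventually_const: "\<exists>s. \<forall>t\<ge>s. seen k p t = seen k p s"
proof -
  obtain C where C: "finite C" "range p \<inter> {..<k} = p ` C"
    using finite_subset_image[of "range p \<inter> {..<k}" p UNIV] by auto
  then obtain s where "C \<subseteq> {..<s}" using finite_nat_iff_bounded by blast
  then have s: "range p \<inter> {..<k} \<subseteq> p ` {..<s}" using C(2) by blast
  have "seen k p t = seen k p s" if "s \<le> t" for t
    using that
  proof (induction t rule: dec_induct)
    case (step t)
    have "p t \<in> set (seen k p s)" if "p t < k"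
      using s that by (auto simp: set_seen)
    then show ?case using step by auto
  qed simp
  then show ?thesis by blast
qed

text \<open>Solutions are subsets of \<open>{..<m}\<close>, and each finite set has just one code.
  The bound is uniform in \<open>f\<close>, so tables with a row for every code of a solution are
  finite.\<close>

lemma set_decode_code_bound:
  "\<exists>A. \<forall>a f. set_decode a \<in> PHP_solutions m f \<longrightarrow> a < A"
proof -
  obtain A where A: "set_encode ` Pow {..<m} \<subseteq> {..<A}"
    using finite_nat_iff_bounded[of "set_encode ` Pow {..<m}"] by auto
  have "a < A" if "set_decode a \<in> PHP_solutions m f" for a f
  proof -
    have "set_decode a \<in> Pow {..<m}" using that by (auto simp: PHP_solutions_def)
    then have "set_encode (set_decode a) \<in> {..<A}" using A by blast
    then show ?thesis by simp
  qed
  then show ?thesis by blast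
qed

text \<open>The program \<open>g\<close> that reads \<open>p\<close> is a parameter: the forward
  functional has \<open>p\<close> itself as oracle, the backward one has \<open>p\<close>
  interleaved with a solution code.\<close>

definition rec_seen :: "nat \<Rightarrow> nat \<Rightarrow> recf \<Rightarrow> recf" where
  "rec_seen k B g = Prim (rec_const (list_encode []))
     (Comp (rec_table2 k B (\<lambda>x c. list_encode
        (if x \<in> set (list_decode c) then list_decode c else list_decode c @ [x])))
       [g, Proj 1])"

lemma rec_eval_seen:
  assumes B: "\<And>s. list_encode (seen k p s) < B"
    and g: "\<And>x y. rec_eval r g [x, y] (p x)"
  shows "rec_eval r (rec_seen k B g) [s] (list_encode (seen k p s))"
proof (induction s)
  case 0
  show ?case unfolding rec_seen_def seen.simps
    by (rule rec_eval.Prim_0) (rule rec_eval_const)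
next
  case (Suc s)
  let ?c = "list_encode (seen k p s)"
  let ?T = "\<lambda>x c. list_encode
        (if x \<in> set (list_decode c) then list_decode c else list_decode c @ [x])"
  have eq: "list_encode (seen k p (Suc s)) = (if p s < k then ?T (p s) ?c else ?c)"
    by simp
  have "rec_eval r (Comp (rec_table2 k B ?T) [g, Proj 1]) [s, ?c] (list_encode (seen k p (Suc s)))"
    unfolding eq
    by (rule rec_eval_Comp2[OF g _ rec_eval_table2[OF B]]) (simp add: rec_eval_Proj)
  then show ?case using Suc unfolding rec_seen_def by (rule rec_eval.Prim_Suc[rotated])
qed

lemma injection_family_imp_weihrauch_le:
  fixes f :: "(nat \<rightharpoonup> nat) \<Rightarrow> nat \<Rightarrow> nat"
  assumes f: "\<And>\<sigma>. \<sigma> \<in> initial_injections k \<Longrightarrow> f \<sigma> \<in> PHP_instances m n"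
    and sep: "\<And>\<sigma> S. \<sigma> \<in> initial_injections k \<Longrightarrow> S \<in> PHP_solutions m (f \<sigma>) \<Longrightarrow>
      \<exists>l<k. \<forall>\<tau>\<in>initial_injections k.
        \<sigma> \<subseteq>\<^sub>m \<tau> \<longrightarrow> S \<in> PHP_solutions m (f \<tau>) \<longrightarrow> l \<notin> ran \<tau>"
  shows "choice k \<le>\<^sub>W PHP_jump m n"
proof -
  obtain L where L: "\<And>\<sigma> S. \<sigma> \<in> initial_injections k \<Longrightarrow> S \<in> PHP_solutions m (f \<sigma>) \<Longrightarrow>
      L \<sigma> S < k \<and> (\<forall>\<tau>\<in>initial_injections k.
        \<sigma> \<subseteq>\<^sub>m \<tau> \<longrightarrow> S \<in> PHP_solutions m (f \<tau>) \<longrightarrow> L \<sigma> S \<notin> ran \<tau>)"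
    using sep by metis
  obtain A where A: "\<And>a g. set_decode a \<in> PHP_solutions m g \<Longrightarrow> a < A"
    using set_decode_code_bound by blast
  have "finite {xs. set xs \<subseteq> {..<k} \<and> distinct xs}"
    by (rule finite_subset_distinct) simp
  then obtain B where B: "list_encode ` {xs. set xs \<subseteq> {..<k} \<and> distinct xs} \<subseteq> {..<B}"
    using finite_nat_iff_bounded by blast
  have seen_B: "list_encode (seen k p s) < B" for p s
  proof -
    have "seen k p s \<in> {xs. set xs \<subseteq> {..<k} \<and> distinct xs}"
      by (auto simp: set_seen distinct_seen)
    then show ?thesis using B by blast
  qed
  define val where "val xs = list_encode (map (f (list_map xs)) [0..<m])" for xs
  \<comment> \<open>The value 0 signals success, because \<open>Mu\<close> searches for a
    zero.\<close>
  define test where "test a c =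
    (if set_decode a \<in> PHP_solutions m (f (list_map (list_decode c))) then 0 else 1 :: nat)" for a c
  define out where "out a c = L (list_map (list_decode c)) (set_decode a)" for a c
  define e1 where "e1 = Comp (rec_table B (\<lambda>c. val (list_decode c)))
    [rec_seen k B (Comp Query [Proj 0])]"
  \<comment> \<open>In the oracle \<open>baire_pair p q\<close>, the value \<open>p x\<close> sits
    at position \<open>2 * x\<close> and \<open>q 0\<close> at position 1.\<close>
  define st where "st = rec_seen k B (Comp Query [Comp rec_double [Proj 0]])"
  define q0 where "q0 = Comp Query [rec_const 1]"
  \<comment> \<open>Search for the first stage at which the given pair solves the current function,
    rebuild the state of that stage and look up its \<open>L\<close>.\<close>
  define e2 where "e2 = Comp (rec_table2 A B out)
    [q0, Comp st [Mu (Comp (rec_table2 A B test) [q0, Comp st [Proj 0]])]]"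
  have "reduces_via (functional_of e1) (functional_of e2) (choice k) (PHP_jump m n)"
    unfolding reduces_via_def
  proof
    fix p
    assume "p \<in> inst_codes (choice k)"
    then have "\<exists>l<k. l \<notin> range p" by (auto simp: inst_codes_def choice_def)
    \<comment> \<open>The omitted \<open>l\<close> keeps the set of seen values a proper subset of
      \<open>{..<k}\<close> at every stage.\<close>
    then have inj: "list_map (seen k p s) \<in> initial_injections k" for s
      by (intro list_map_in_initial_injections distinct_seen) (auto simp: set_seen)
    obtain s0 where s0: "\<And>t. t \<ge> s0 \<Longrightarrow> seen k p t = seen k p s0"
      using seen_eventually_const by blast
    define F where "F s = f (list_map (seen k p s))" for s
    define p' where "p' s = val (seen k p s)" for s
    have F: "F s \<in> PHP_instances m n" for s using f inj by (simp add: F_def)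
    have "F s = F s0" if "s0 \<le> s" for s
      unfolding F_def s0[OF that] by (rule refl)
    then have lim: "(\<lambda>s. F s i) \<longlonglongrightarrow> F s0 i" for i
      by (intro tendsto_eventually eventually_sequentiallyI[of s0]) metis
    have rep: "inst_rep (PHP_jump m n) p' = Some F"
    proof -
      have "F s i = undefined" if "\<not> i < m" for s i
        using F[of s] that by (auto simp: PHP_instances_def PiE_def extensional_def)
      then show ?thesis by (auto simp: PHP_jump_def p'_def val_def F_def fun_eq_iff)
    qed
    have inst: "F \<in> instances (PHP_jump m n)"
      using F lim by (auto simp: PHP_jump_def convergent_def)
    have "(\<lambda>i\<in>{..<m}. lim (\<lambda>s. F s i)) = F s0"
      using F[of s0] limI[OF lim]
      by (auto simp: fun_eq_iff PHP_instances_def PiE_def extensional_def)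
    then have sols: "solutions (PHP_jump m n) F = PHP_solutions m (F s0)"
      by (simp add: PHP_jump_def)
    have "rec_eval p e1 [s] (p' s)" for s
    proof -
      have "rec_eval p (rec_table B (\<lambda>c. val (list_decode c))) [list_encode (seen k p s)]
          (val (list_decode (list_encode (seen k p s))))"
        by (rule rec_eval_table[OF seen_B])
      moreover have "rec_eval p (rec_seen k B (Comp Query [Proj 0])) [s] (list_encode (seen k p s))"
        by (rule rec_eval_seen[OF seen_B rec_eval_Comp1[OF _ rec_eval.Query]])
          (simp add: rec_eval_Proj)
      ultimately show ?thesis unfolding e1_def p'_def by (simp add: rec_eval_Comp1)
    qed
    then have \<Phi>: "functional_of e1 p = Some p'" by (simp add: functional_of_eq_Some_iff)
    have \<Psi>: "\<exists>r\<in>sol_codes (choice k) p. functional_of e2 (baire_pair p q) = Some r"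
      if q: "q \<in> sol_codes (PHP_jump m n) p'" for q
    proof -
      let ?r = "baire_pair p q"
      define S where "S = set_decode (q 0)"
      have S: "S \<in> PHP_solutions m (F s0)"
        using q rep sols by (auto simp: sol_codes_def PHP_jump_def S_def)
      \<comment> \<open>The code of the solution is a genuine row index, so the table lookups avoid
        the default.\<close>
      then have qA: "q 0 < A" using A by (simp add: S_def)
      have q0: "rec_eval ?r q0 xs (q 0)" for xs
      proof -
        have "?r 1 = q 0" by (simp add: baire_pair_def)
        then show ?thesis unfolding q0_def
          by (metis rec_eval_Comp1 rec_eval_const rec_eval.Query)
      qed
      have query: "rec_eval ?r (Comp Query [Comp rec_double [Proj 0]]) [x, y] (p x)" for x y
      proof -
        have "rec_eval ?r (Comp rec_double [Proj 0]) [x, y] (2 * x)"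
          by (rule rec_eval_Comp1[OF _ rec_eval_double]) (simp add: rec_eval_Proj)
        moreover have "?r (2 * x) = p x" by (simp add: baire_pair_def)
        ultimately show ?thesis by (metis rec_eval_Comp1 rec_eval.Query)
      qed
      have st: "rec_eval ?r st [s] (list_encode (seen k p s))" for s
        unfolding st_def by (rule rec_eval_seen[OF seen_B query])
      define P where "P s \<longleftrightarrow> S \<in> PHP_solutions m (F s)" for s
      define s1 where "s1 = (LEAST s. P s)"
      \<comment> \<open>The stage \<open>s0\<close>, where the limit is reached, guarantees that the
        search ends; it stops at \<open>s1\<close>, possibly earlier.\<close>
      have "P s0" using S by (simp add: P_def)
      then have s1: "P s1" unfolding s1_def by (rule LeastI)
      have tst: "rec_eval ?r (Comp (rec_table2 A B test) [q0, Comp st [Proj 0]]) [s, x]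
          (if P s then 0 else Suc 0)" for s x
      proof -
        have "rec_eval ?r (Comp st [Proj 0]) [s, x] (list_encode (seen k p s))"
          by (rule rec_eval_Comp1[OF _ st]) (simp add: rec_eval_Proj)
        from rec_eval_Comp2[OF q0 this rec_eval_table2[OF seen_B, where A = A and h = test]]
        show ?thesis
          using qA by (simp add: test_def P_def F_def S_def split: if_splits)
      qed
      have mu: "rec_eval ?r (Mu (Comp (rec_table2 A B test) [q0, Comp st [Proj 0]])) [x] s1" for x
      proof (rule rec_eval.Mu)
        show "rec_eval ?r (Comp (rec_table2 A B test) [q0, Comp st [Proj 0]]) [s1, x] 0"
          using tst[of s1 x] s1 by simp
        have "\<not> P z" if "z < s1" for z using that not_less_Least unfolding s1_def by blast
        then show "\<forall>z<s1. \<exists>v. rec_eval ?r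
            (Comp (rec_table2 A B test) [q0, Comp st [Proj 0]]) [z, x] (Suc v)"
          using tst by metis
      qed
      define l where "l = L (list_map (seen k p s1)) S"
      have "rec_eval ?r e2 [x] l" for x
        using rec_eval_Comp2[OF q0 rec_eval_Comp1[OF mu st]
            rec_eval_table2[OF seen_B, where A = A and h = out]] qA
        unfolding e2_def by (simp add: out_def l_def S_def)
      then have "functional_of e2 ?r = Some (\<lambda>_. l)" by (simp add: functional_of_eq_Some_iff)
      moreover have "(\<lambda>_. l) \<in> sol_codes (choice k) p"
      proof -
        have L1: "l < k" "\<And>\<tau>. \<tau> \<in> initial_injections k \<Longrightarrow> list_map (seen k p s1) \<subseteq>\<^sub>m \<tau> \<Longrightarrow>
            S \<in> PHP_solutions m (f \<tau>) \<Longrightarrow> l \<notin> ran \<tau>"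
          using L[OF inj[of s1], of S] s1 by (auto simp: P_def F_def l_def)
        have "l \<notin> range p"
        proof
          assume "l \<in> range p"
          then obtain x where x: "p x = l" by auto
          \<comment> \<open>By stage \<open>t\<close> the value \<open>l\<close> has been enumerated
            and the limit reached. The injection of stage \<open>t\<close> thus extends that of
            \<open>s1\<close>, still has \<open>S\<close> as a solution, and has \<open>l\<close> in
            its range, against the choice of \<open>L\<close>.\<close>
          define t where "t = Max {s0, s1, Suc x}"
          have t: "s0 \<le> t" "s1 \<le> t" "x < t" by (auto simp: t_def)
          have "l \<in> ran (list_map (seen k p t))"
            using x t L1(1) by (auto simp: ran_list_map set_seen)
          moreover have "list_map (seen k p s1) \<subseteq>\<^sub>m list_map (seen k p t)"
            using seen_append[OF t(2)] list_map_append by metis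
          moreover have "S \<in> PHP_solutions m (f (list_map (seen k p t)))"
            using S s0[OF t(1)] by (simp add: F_def)
          ultimately show False using L1(2) inj by blast
        qed
        then show ?thesis using L1(1) by (auto simp: sol_codes_def choice_def)
      qed
      ultimately show ?thesis by blast
    qed
    have "p' \<in> inst_codes (PHP_jump m n)" using rep inst by (auto simp: inst_codes_def)
    then show "\<exists>p'\<in>inst_codes (PHP_jump m n). functional_of e1 p = Some p' \<and>
        (\<forall>q\<in>sol_codes (PHP_jump m n) p'.
          \<exists>r\<in>sol_codes (choice k) p. functional_of e2 (baire_pair p q) = Some r)"
      using \<Phi> \<Psi> by blast
  qed
  then show ?thesis unfolding weihrauch_le_def using turing_functional_of by blast
qed

section \<open>From a continuous reduction to injection-indexed functions\<close>

definition pad :: "nat \<Rightarrow> nat list \<Rightarrow> baire" where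
  "pad k u = (\<lambda>i. if i < length u then u ! i else k)"

text \<open>Waiting is free: a block of \<open>k\<close> can be made part of the prefix without
  changing the instance.\<close>

lemma pad_append_replicate: "pad k (u @ replicate N k) = pad k u"
  by (auto simp: pad_def fun_eq_iff nth_append)

lemma agree_pad_append: "N \<le> length u \<Longrightarrow> agree N (pad k u) (pad k (u @ v))"
  by (auto simp: agree_def pad_def nth_append)

lemma range_pad: "range (pad k u) = insert k (set u)"
proof -
  have "k \<in> range (pad k u)" by (rule range_eqI[of _ _ "length u"]) (simp add: pad_def)
  moreover have "u ! i \<in> range (pad k u)" if "i < length u" for i
    using that by (intro range_eqI[of _ _ i]) (simp add: pad_def)
  ultimately show ?thesis by (auto simp: pad_def in_set_conv_nth split: if_splits)
qed

text \<open>The list argument is read from its last element to its first, and each element is followed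
  by a block of the neutral symbol \<open>k\<close> whose length \<open>N\<close> may depend on everything before it.\<close>

primrec blocks :: "nat \<Rightarrow> (nat list \<Rightarrow> nat) \<Rightarrow> nat list \<Rightarrow> nat list" where
  "blocks k N [] = replicate (N []) k"
| "blocks k N (x # xs) =
    (let u = blocks k N xs @ [x] in u @ replicate (N u) k)"

text \<open>The symbol \<open>k\<close> is inserted on both sides because padding blocks may be
  empty.\<close>

lemma insert_set_blocks: "insert k (set (blocks k N xs)) = insert k (set xs)"
proof (induction xs)
  case Nil
  show ?case by (auto simp: set_replicate_conv_if)
next
  case (Cons x xs)
  have "insert k (set (blocks k N (x # xs))) = insert x (insert k (set (blocks k N xs)))"
    by (auto simp: Let_def set_replicate_conv_if)
  then show ?case unfolding Cons by auto
qed

lemma blocks_append: "\<exists>v. blocks k N (ys @ xs) = blocks k N xs @ v"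
  by (induction ys) (auto simp: Let_def)

text \<open>Here \<open>u\<close> is the prefix just before the last padding block, at which the
  length \<open>N u\<close> is chosen.\<close>

lemma blocks_eq_padded: "\<exists>u. blocks k N xs = u @ replicate (N u) k"
  by (cases xs) (simp, metis append_Nil, metis blocks.simps(2))

text \<open>Reversed, since \<open>blocks\<close> treats the head as the latest element; extending
  an injection then means prepending to the list.\<close>

definition map_list :: "(nat \<rightharpoonup> nat) \<Rightarrow> nat list" where
  "map_list \<sigma> = rev (map (\<lambda>i. the (\<sigma> i)) [0..<card (dom \<sigma>)])"

lemma set_map_list:
  assumes "\<sigma> \<in> initial_injections k" shows "set (map_list \<sigma>) = ran \<sigma>"
proof -
  obtain t where t: "dom \<sigma> = {..<t}" using assms by (auto simp: initial_injections_def)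
  have "ran \<sigma> = (\<lambda>i. the (\<sigma> i)) ` dom \<sigma>" by (force simp: ran_def dom_def image_iff)
  then show ?thesis by (auto simp: map_list_def t)
qed

text \<open>The domain has fewer than \<open>k\<close> elements, so some value below
  \<open>k\<close> is omitted; this makes the padded enumeration an instance of
  \<open>choice k\<close>.\<close>

lemma ran_initial_injection:
  assumes "\<sigma> \<in> initial_injections k" shows "ran \<sigma> \<subset> {..<k}"
proof -
  obtain t where t: "dom \<sigma> = {..<t}" "t < k" using assms by (auto simp: initial_injections_def)
  have "ran \<sigma> = (\<lambda>i. the (\<sigma> i)) ` dom \<sigma>" by (force simp: ran_def dom_def image_iff)
  then have "card (ran \<sigma>) < k" using t card_image_le[of "{..<t}" "\<lambda>i. the (\<sigma> i)"] by simp
  moreover have "ran \<sigma> \<subseteq> {..<k}" using assms by (auto simp: initial_injections_def)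
  ultimately show ?thesis by (metis card_lessThan nless_le psubsetI)
qed

lemma map_list_extends:
  assumes "\<sigma> \<in> initial_injections k" "\<tau> \<in> initial_injections k" "\<sigma> \<subseteq>\<^sub>m \<tau>"
  shows "\<exists>zs. map_list \<tau> = zs @ map_list \<sigma>"
proof -
  obtain s t where st: "dom \<sigma> = {..<s}" "dom \<tau> = {..<t}"
    using assms(1,2) by (auto simp: initial_injections_def)
  have "{..<s} \<subseteq> {..<t}" using assms(3) st map_le_implies_dom_le by metis
  then have "[0..<t] = [0..<s] @ [s..<t]" using upt_add_eq_append[of 0 s "t - s"] by simp
  moreover have "map (\<lambda>i. the (\<tau> i)) [0..<s] = map (\<lambda>i. the (\<sigma> i)) [0..<s]"
    using assms(3) st(1) by (auto simp: map_le_def)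
  ultimately show ?thesis by (auto simp: map_list_def st)
qed

text \<open>For one \<open>S\<close>, continuity of \<open>\<Psi>\<close> fixes the first entry
  \<open>l\<close> of the answer on a neighbourhood. Every instance \<open>r\<close> there for which
  \<open>S\<close> is still a solution gets the same answer, and its correctness means that
  \<open>r\<close> omits \<open>l\<close>. The finitely many \<open>S\<close> can share one
  \<open>N\<close>.\<close>

lemma solution_commits:
  assumes red: "reduces_via \<Phi> \<Psi> (choice k) (PHP_jump m n)"
    and \<Psi>: "continuous_functional \<Psi>"
    and p: "p \<in> inst_codes (choice k)" "\<Phi> p = Some p'"
  shows "\<exists>N. \<forall>S. (\<lambda>_. set_encode S) \<in> sol_codes (PHP_jump m n) p' \<longrightarrow> finite S \<longrightarrow>
    (\<exists>l<k. \<forall>r r'. agree N p r \<longrightarrow> r \<in> inst_codes (choice k) \<longrightarrow> \<Phi> r = Some r' \<longrightarrow>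
      (\<lambda>_. set_encode S) \<in> sol_codes (PHP_jump m n) r' \<longrightarrow> l \<notin> range r)"
proof -
  define code :: "nat set \<Rightarrow> baire" where "code S = (\<lambda>_. set_encode S)" for S
  define X where "X = {S. finite S \<and> code S \<in> sol_codes (PHP_jump m n) p'}"
  define Q where "Q N S \<longleftrightarrow> (\<exists>l<k. \<forall>r r'. agree N p r \<longrightarrow> r \<in> inst_codes (choice k) \<longrightarrow>
      \<Phi> r = Some r' \<longrightarrow> code S \<in> sol_codes (PHP_jump m n) r' \<longrightarrow> l \<notin> range r)" for N S
  have "finite X"
  proof -
    obtain A where A: "\<And>a f. set_decode a \<in> PHP_solutions m f \<Longrightarrow> a < A"
      using set_decode_code_bound by blast
    have "X \<subseteq> set_decode ` {..<A}"
    proof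
      fix S assume "S \<in> X"
      then have "finite S" "set_encode S < A"
        by (auto simp: X_def sol_codes_def PHP_jump_def code_def intro!: A split: if_splits)
      then show "S \<in> set_decode ` {..<A}" by (intro image_eqI[of _ _ "set_encode S"]) auto
    qed
    then show ?thesis by (rule finite_subset) simp
  qed
  have "\<exists>N. Q N S" if S: "S \<in> X" for S
  proof -
    obtain r0 where r0: "r0 \<in> sol_codes (choice k) p" "\<Psi> (baire_pair p (code S)) = Some r0"
      using red p S unfolding reduces_via_def X_def by fastforce
    obtain N where N: "\<And>x y. agree N (baire_pair p (code S)) x \<Longrightarrow> \<Psi> x = Some y \<Longrightarrow> y 0 = r0 0"
      using \<Psi> r0(2) unfolding continuous_functional_iff by blast
    have "r0 0 \<notin> range r" if r: "agree N p r" "r \<in> inst_codes (choice k)" "\<Phi> r = Some r'"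
      "code S \<in> sol_codes (PHP_jump m n) r'" for r r'
    proof -
      obtain y where y: "y \<in> sol_codes (choice k) r" "\<Psi> (baire_pair r (code S)) = Some y"
        using red r unfolding reduces_via_def by fastforce
      \<comment> \<open>If \<open>i < N\<close>, then \<open>i div 2 < N\<close>; the odd positions
        carry the same code on both sides.\<close>
      have "agree N (baire_pair p (code S)) (baire_pair r (code S))"
        using r(1) by (auto simp: agree_def baire_pair_def)
      then have "y 0 = r0 0" using N y(2) by blast
      then show ?thesis using y(1) by (auto simp: sol_codes_def choice_def)
    qed
    moreover have "r0 0 < k" using r0(1) by (auto simp: sol_codes_def choice_def)
    ultimately show ?thesis unfolding Q_def by blast
  qed
  then obtain N where N: "\<And>S. S \<in> X \<Longrightarrow> Q (N S) S" by metis
  have "Q (\<Sum>S\<in>X. N S) S" if "S \<in> X" for S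
  proof -
    have "N S \<le> (\<Sum>S\<in>X. N S)" using that \<open>finite X\<close> by (intro member_le_sum) auto
    then show ?thesis using N[OF that] agree_mono unfolding Q_def by meson
  qed
  then show ?thesis unfolding Q_def X_def code_def by blast
qed

lemma weihrauch_cont_le_imp_injection_family:
  assumes "choice k \<le>\<^sup>*\<^sub>W PHP_jump m n"
  shows "\<exists>f :: (nat \<rightharpoonup> nat) \<Rightarrow> nat \<Rightarrow> nat.
         (\<forall>\<sigma>\<in>initial_injections k. f \<sigma> \<in> PHP_instances m n) \<and>
         (\<forall>\<sigma>\<in>initial_injections k. \<forall>S\<in>PHP_solutions m (f \<sigma>).
            \<exists>l<k. \<forall>\<tau>\<in>initial_injections k.
              \<sigma> \<subseteq>\<^sub>m \<tau> \<longrightarrow> S \<in> PHP_solutions m (f \<tau>) \<longrightarrow> l \<notin> ran \<tau>)"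
proof -
  obtain \<Phi> \<Psi> where \<Psi>: "continuous_functional \<Psi>"
    and red: "reduces_via \<Phi> \<Psi> (choice k) (PHP_jump m n)"
    using assms unfolding weihrauch_cont_le_def by blast
  define code :: "nat set \<Rightarrow> baire" where "code S = (\<lambda>_. set_encode S)" for S
  define good where "good u N \<longleftrightarrow> (\<forall>S. code S \<in> sol_codes (PHP_jump m n) (the (\<Phi> (pad k u))) \<longrightarrow>
    finite S \<longrightarrow> (\<exists>l<k. \<forall>r r'. agree N (pad k u) r \<longrightarrow> r \<in> inst_codes (choice k) \<longrightarrow>
      \<Phi> r = Some r' \<longrightarrow> code S \<in> sol_codes (PHP_jump m n) r' \<longrightarrow> l \<notin> range r))" for u N
  \<comment> \<open>\<open>blocks\<close> needs a total function on lists;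
    \<open>good u (N u)\<close> is claimed only if \<open>pad k u\<close> is an instance.\<close>
  define N where "N u = (SOME N. good u N)" for u
  have good: "good u (N u)" if u: "pad k u \<in> inst_codes (choice k)" for u
  proof -
    obtain p' where "\<Phi> (pad k u) = Some p'"
      using bspec[OF red[unfolded reduces_via_def] u] by (elim bexE conjE)
    then have "\<exists>N. good u N"
      using solution_commits[OF red \<Psi> u] unfolding good_def code_def by simp
    then show ?thesis unfolding N_def by (rule someI_ex)
  qed
  \<comment> \<open>\<open>P \<sigma>\<close> lists the values of \<open>\<sigma>\<close> separated
    by waiting blocks and then stays at \<open>k\<close>; \<open>f \<sigma>\<close> will be the
    limit of the sequence coded by its image under \<open>\<Phi>\<close>.\<close>
  define P where "P \<sigma> = pad k (blocks k N (map_list \<sigma>))" for \<sigma>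
  define F where "F \<sigma> = the (inst_rep (PHP_jump m n) (the (\<Phi> (P \<sigma>))))" for \<sigma>
  define f where "f \<sigma> = (\<lambda>i\<in>{..<m}. lim (\<lambda>s. F \<sigma> s i))" for \<sigma>
  have range_P: "range (P \<sigma>) = insert k (ran \<sigma>)" if "\<sigma> \<in> initial_injections k" for \<sigma>
    using set_map_list[OF that] by (simp add: P_def range_pad insert_set_blocks)
  have inst: "P \<sigma> \<in> inst_codes (choice k)" if "\<sigma> \<in> initial_injections k" for \<sigma>
    using range_P[OF that] ran_initial_injection[OF that]
    by (auto simp: inst_codes_def choice_def)
  have \<Phi>: "\<Phi> (P \<sigma>) = Some (the (\<Phi> (P \<sigma>)))"
    "inst_rep (PHP_jump m n) (the (\<Phi> (P \<sigma>))) = Some (F \<sigma>)" "F \<sigma> \<in> instances (PHP_jump m n)"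
    if \<sigma>: "\<sigma> \<in> initial_injections k" for \<sigma>
  proof -
    obtain p' where p': "p' \<in> inst_codes (PHP_jump m n)" "\<Phi> (P \<sigma>) = Some p'"
      using bspec[OF red[unfolded reduces_via_def] inst[OF \<sigma>]] by (elim bexE conjE)
    then show "\<Phi> (P \<sigma>) = Some (the (\<Phi> (P \<sigma>)))"
      "inst_rep (PHP_jump m n) (the (\<Phi> (P \<sigma>))) = Some (F \<sigma>)" "F \<sigma> \<in> instances (PHP_jump m n)"
      by (auto simp: F_def inst_codes_def)
  qed
  have fin: "finite S" if "S \<in> PHP_solutions m g" for S g
    using that by (auto simp: PHP_solutions_def)
  have code: "code S \<in> sol_codes (PHP_jump m n) (the (\<Phi> (P \<sigma>)))"
    if "\<sigma> \<in> initial_injections k" "S \<in> PHP_solutions m (f \<sigma>)" for \<sigma> S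
  proof -
    have "S \<in> solutions (PHP_jump m n) (F \<sigma>)" "sol_rep (PHP_jump m n) (code S) = Some S"
      using that(2) fin[OF that(2)] by (simp_all add: PHP_jump_def f_def code_def)
    then show ?thesis using \<Phi>(2)[OF that(1)] by (auto simp: sol_codes_def)
  qed
  have "\<exists>l<k. \<forall>\<tau>\<in>initial_injections k.
      \<sigma> \<subseteq>\<^sub>m \<tau> \<longrightarrow> S \<in> PHP_solutions m (f \<tau>) \<longrightarrow> l \<notin> ran \<tau>"
    if \<sigma>: "\<sigma> \<in> initial_injections k" and S: "S \<in> PHP_solutions m (f \<sigma>)" for \<sigma> S
  proof -
    obtain u where u: "blocks k N (map_list \<sigma>) = u @ replicate (N u) k"
      using blocks_eq_padded by blast
    \<comment> \<open>The final block is absorbed by the padding, so the commitment made at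
      \<open>u\<close> concerns exactly \<open>P \<sigma>\<close>.\<close>
    have Pu: "P \<sigma> = pad k u" by (simp add: P_def u pad_append_replicate)
    obtain l where l: "l < k" "\<And>r r'. agree (N u) (P \<sigma>) r \<Longrightarrow> r \<in> inst_codes (choice k) \<Longrightarrow>
        \<Phi> r = Some r' \<Longrightarrow> code S \<in> sol_codes (PHP_jump m n) r' \<Longrightarrow> l \<notin> range r"
      using good[of u] inst[OF \<sigma>] code[OF \<sigma> S] fin[OF S] unfolding Pu good_def by blast
    have "l \<notin> ran \<tau>" if \<tau>: "\<tau> \<in> initial_injections k" "\<sigma> \<subseteq>\<^sub>m \<tau>" "S \<in> PHP_solutions m (f \<tau>)" for \<tau>
    proof -
      obtain v where "blocks k N (map_list \<tau>) = blocks k N (map_list \<sigma>) @ v"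
        using map_list_extends[OF \<sigma> \<tau>(1,2)] blocks_append by metis
      \<comment> \<open>The enumeration of \<open>\<tau>\<close> begins with that of
        \<open>\<sigma>\<close>, whose final block alone has length \<open>N u\<close>.\<close>
      then have "agree (N u) (P \<sigma>) (P \<tau>)"
        unfolding P_def by (simp add: u agree_pad_append del: append_assoc)
      then have "l \<notin> range (P \<tau>)"
        using l(2) inst[OF \<tau>(1)] \<Phi>(1)[OF \<tau>(1)] code[OF \<tau>(1,3)] by blast
      then show ?thesis using range_P[OF \<tau>(1)] by blast
    qed
    then show ?thesis using l(1) by blast
  qed
  moreover have "f \<sigma> \<in> PHP_instances m n" if "\<sigma> \<in> initial_injections k" for \<sigma>
    unfolding f_def using \<Phi>(3)[OF that] by (rule lim_in_PHP_instances)
  ultimately show ?thesis by blast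
qed

theorem theorem3p17:
  fixes k m n :: nat
  assumes "k \<ge> 2" and "n \<ge> 2" and "m > n"
  shows
    "((\<exists>f :: (nat \<rightharpoonup> nat) \<Rightarrow> nat \<Rightarrow> nat.
         (\<forall>\<sigma>\<in>initial_injections k. f \<sigma> \<in> PHP_instances m n) \<and>
         (\<forall>\<sigma>\<in>initial_injections k. \<forall>S\<in>PHP_solutions m (f \<sigma>).
            \<exists>l<k. \<forall>\<tau>\<in>initial_injections k.
              \<sigma> \<subseteq>\<^sub>m \<tau> \<longrightarrow> S \<in> PHP_solutions m (f \<tau>) \<longrightarrow> l \<notin> ran \<tau>))
       \<longleftrightarrow> choice k \<le>\<^sub>W PHP_jump m n) \<and>
     (choice k \<le>\<^sub>W PHP_jump m n \<longleftrightarrow> choice k \<le>\<^sup>*\<^sub>W PHP_jump m n)"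
    (is "(?family \<longleftrightarrow> ?W) \<and> (?W \<longleftrightarrow> ?C)")
proof -
  have "?family \<Longrightarrow> ?W"
    using injection_family_imp_weihrauch_le by blast
  moreover have "?W \<Longrightarrow> ?C" by (rule weihrauch_le_imp_cont)
  moreover have "?C \<Longrightarrow> ?family" by (rule weihrauch_cont_le_imp_injection_family)
  ultimately show ?thesis by blast
qed

end
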